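(* Let $L$ be a finite trim lattice and fix $p\in(0,1]$. Then $\mathcal E(L)\leq\mathcal E(\mathrm{spine}(L))$.
   Context: For a finite lattice $L$ and $x\in L$, let $\mathrm{cov}_L(x)$ be the set of elements covered by $x$. The Ungarian Markov chain ${\bf U}_L$ (with fixed probability $p$) has state space $L$: from state $x$, form a random subset $T\subseteq\mathrm{cov}_L(x)$ by including each element independently with probability $p$, and move to $\bigwedge(\{x\}\cup T)$. $\mathcal E(L)$ is the expected number of steps to reach the bottom element $\hat 0$ from the top element $\hat 1$. An element is join-irreducible (resp. meet-irreducible) if it covers (resp. is covered by) exactly one element. A finite lattice is extremal if its length (maximum length of a chain) equals both the number of join-irreducible elements and the number of meet-irreducible elements. An element $x$ is left modular if $(y\vee x)\wedge z=y\vee(x\wedge z)$ for all $y\le z$; a lattice is left modular if it has a maximal chain consisting of left modular elements. A lattice is trim if it is extremal and left modular. The spine $\mathrm{spine}(L)$ of a trim lattice $L$ is the set of elements lying on at least one maximum-length chain of $L$; it is a (distributive) sublattice of $L$, viewed as a lattice in its own right. *)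

theory Defs
  imports "HOL-Probability.Probability" "HOL-Algebra.Lattice"
begin

section \<open>Trim lattices\<close>

definition lower_covers :: "('a, 'b) gorder_scheme \<Rightarrow> 'a \<Rightarrow> 'a set" where
  "lower_covers L x =
     {y \<in> carrier L. y \<sqsubset>\<^bsub>L\<^esub> x \<and> \<not> (\<exists>z\<in>carrier L. y \<sqsubset>\<^bsub>L\<^esub> z \<and> z \<sqsubset>\<^bsub>L\<^esub> x)}"

definition join_irreducibles :: "('a, 'b) gorder_scheme \<Rightarrow> 'a set" where
  "join_irreducibles L = {x \<in> carrier L. \<exists>!y. y \<in> lower_covers L x}"

definition meet_irreducibles :: "('a, 'b) gorder_scheme \<Rightarrow> 'a set" where
  "meet_irreducibles L = {x \<in> carrier L. \<exists>!y. y \<in> carrier L \<and> x \<in> lower_covers L y}"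

abbreviation chain_of :: "('a, 'b) gorder_scheme \<Rightarrow> 'a set \<Rightarrow> bool" where
  "chain_of L \<equiv> pred_on.chain (carrier L) (lless L)"

abbreviation maximal_chain_of :: "('a, 'b) gorder_scheme \<Rightarrow> 'a set \<Rightarrow> bool" where
  "maximal_chain_of L \<equiv> pred_on.maxchain (carrier L) (lless L)"

text \<open>
  A chain with \<open>n + 1\<close> elements has length \<open>n\<close>. The maximum is meaningful for a finite
  carrier only.
\<close>
definition lattice_length :: "('a, 'b) gorder_scheme \<Rightarrow> nat" where
  "lattice_length L = Max {card C - 1 | C. chain_of L C \<and> C \<noteq> {}}"

definition extremal :: "('a, 'b) gorder_scheme \<Rightarrow> bool" where
  "extremal L \<longleftrightarrow>
     lattice_length L = card (join_irreducibles L) \<and>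
     lattice_length L = card (meet_irreducibles L)"

definition left_modular_elem :: "('a, 'b) gorder_scheme \<Rightarrow> 'a \<Rightarrow> bool" where
  "left_modular_elem L x \<longleftrightarrow>
     x \<in> carrier L \<and>
     (\<forall>y\<in>carrier L. \<forall>z\<in>carrier L. y \<sqsubseteq>\<^bsub>L\<^esub> z \<longrightarrow>
        (y \<squnion>\<^bsub>L\<^esub> x) \<sqinter>\<^bsub>L\<^esub> z = y \<squnion>\<^bsub>L\<^esub> (x \<sqinter>\<^bsub>L\<^esub> z))"

definition left_modular :: "('a, 'b) gorder_scheme \<Rightarrow> bool" where
  "left_modular L \<longleftrightarrow> (\<exists>C. maximal_chain_of L C \<and> (\<forall>x\<in>C. left_modular_elem L x))"

definition trim :: "('a, 'b) gorder_scheme \<Rightarrow> bool" where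
  "trim L \<longleftrightarrow> extremal L \<and> left_modular L"

definition spine_set :: "('a, 'b) gorder_scheme \<Rightarrow> 'a set" where
  "spine_set L =
     {x. \<exists>C. chain_of L C \<and> C \<noteq> {} \<and> card C - 1 = lattice_length L \<and> x \<in> C}"

text \<open>
  The spine carries the induced order; its covers, meets, top and bottom are computed inside
  the spine.
\<close>
definition spine :: "('a, 'b) gorder_scheme \<Rightarrow> ('a, 'b) gorder_scheme" where
  "spine L = L\<lparr>carrier := spine_set L\<rparr>"


section \<open>Discrete-time Markov chains\<close>

text \<open>
  The Ionescu-Tulcea kernels of the Markov chain with initial state \<open>x\<close> and transition kernel
  \<open>K\<close>: coordinate \<open>0\<close> is \<open>x\<close>, and coordinate \<open>i + 1\<close> is drawn from \<open>K\<close> at the state in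
  coordinate \<open>i\<close>.
\<close>
definition markov_step :: "('a \<Rightarrow> 'a pmf) \<Rightarrow> 'a \<Rightarrow> nat \<Rightarrow> (nat \<Rightarrow> 'a) \<Rightarrow> 'a measure" where
  "markov_step K x i \<omega> =
     measure_pmf (case i of 0 \<Rightarrow> return_pmf x | Suc j \<Rightarrow> K (\<omega> j))"

lemma Ionescu_Tulcea_markov_step:
  "Ionescu_Tulcea (markov_step K x) (\<lambda>_. count_space UNIV)"
proof (rule Ionescu_Tulcea.intro)
  fix i
  show "markov_step K x i
          \<in> measurable (PiM {0..<i} (\<lambda>_. count_space UNIV)) (subprob_algebra (count_space UNIV))"
  proof (cases i)
    case 0
    then show ?thesis
      unfolding markov_step_def by (simp add: measure_pmf_in_subprob_algebra)
  next
    case (Suc j)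
    have "(\<lambda>\<omega>. measure_pmf (K (\<omega> j)))
            \<in> measurable (PiM {0..<i} (\<lambda>_. count_space UNIV)) (subprob_algebra (count_space UNIV))"
      by (rule measurable_compose[where f = "\<lambda>\<omega>. \<omega> j" and N = "count_space UNIV"])
         (auto simp: Suc measure_pmf_in_subprob_algebra intro!: measurable_component_singleton)
    then show ?thesis
      by (simp add: Suc markov_step_def[abs_def])
  qed
next
  fix i \<omega>
  show "prob_space (markov_step K x i \<omega>)"
    unfolding markov_step_def by (rule prob_space_measure_pmf)
qed

text \<open>The law of the whole trajectory, given by the Ionescu-Tulcea theorem.\<close>
definition markov_chain :: "('a \<Rightarrow> 'a pmf) \<Rightarrow> 'a \<Rightarrow> (nat \<Rightarrow> 'a) measure" where
  "markov_chain K x =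
     projective_family.lim UNIV
       (Ionescu_Tulcea.CI (markov_step K x) (\<lambda>_. count_space UNIV)) (\<lambda>_. count_space UNIV)"

lemma distr_markov_chain:
  assumes "finite J"
  shows "distr (markov_chain K x) (PiM J (\<lambda>_. count_space UNIV)) (\<lambda>\<omega>. restrict \<omega> J) =
         Ionescu_Tulcea.CI (markov_step K x) (\<lambda>_. count_space UNIV) J"
  unfolding markov_chain_def
  by (rule Ionescu_Tulcea.distr_lim[OF Ionescu_Tulcea_markov_step assms])

text \<open>The value is \<open>\<infinity>\<close> if \<open>\<omega>\<close> never visits \<open>y\<close>.\<close>
definition hitting_time :: "'a \<Rightarrow> (nat \<Rightarrow> 'a) \<Rightarrow> ennreal" where
  "hitting_time y \<omega> = (INF n\<in>{n. \<omega> n = y}. of_nat n)"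


section \<open>The Ungarian Markov chain\<close>

definition ungar_step :: "real \<Rightarrow> ('a, 'b) gorder_scheme \<Rightarrow> 'a \<Rightarrow> 'a pmf" where
  "ungar_step p L x =
     map_pmf (\<lambda>f. \<Sqinter>\<^bsub>L\<^esub>({x} \<union> {y \<in> lower_covers L x. f y}))
       (Pi_pmf (lower_covers L x) False (\<lambda>_. bernoulli_pmf p))"

definition expected_ungar_time :: "real \<Rightarrow> ('a, 'b) gorder_scheme \<Rightarrow> ennreal" where
  "expected_ungar_time p L =
     (\<integral>\<^sup>+\<omega>. hitting_time \<bottom>\<^bsub>L\<^esub> \<omega> \<partial>markov_chain (ungar_step p L) \<top>\<^bsub>L\<^esub>)"

end

theory Submission
  imports Defs
begin

text \<open>
  A longest chain of an extremal lattice gains exactly one join-irreducible \<open>j\<^sub>k\<close> and loses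
  exactly one meet-irreducible \<open>m\<^sub>k\<close> at its \<open>k\<close>-th step, and \<open>j\<^sub>k \<le> m\<^sub>k\<close> fails. Counting shows
  that the spine consists of those \<open>s\<close> with \<open>j\<^sub>k \<le> s\<close> or \<open>s \<le> m\<^sub>k\<close> for every \<open>k\<close>. Hence the spine
  is closed under meets and joins, and below \<open>s\<close> each of its lower covers loses a single \<open>j\<^sub>k\<close>.
  If \<open>a \<le> s\<close>, then \<open>t \<mapsto> a \<sqinter> t\<close> therefore maps the lower covers \<open>t\<close> of \<open>s\<close> in the spine with
  \<open>\<not> a \<le> t\<close> injectively to lower covers of \<open>a\<close>. Sharing the coins along this map couples a step
  from \<open>a\<close> in \<open>L\<close> with a step from \<open>s\<close> in the spine so that the order is preserved; so the chain
  on \<open>L\<close> stays below the chain on the spine and reaches the bottom no later.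
\<close>

section \<open>Expected hitting times\<close>

text \<open>The transition operator of the chain killed at \<open>y\<close>. Its \<open>n\<close>-th
  iterate on \<open>indicator (- {y})\<close> is the probability that the chain avoids
  \<open>y\<close> at all times from \<open>0\<close> to \<open>n\<close>.\<close>

definition killed :: "('a \<Rightarrow> 'a pmf) \<Rightarrow> 'a \<Rightarrow> ('a \<Rightarrow> ennreal) \<Rightarrow> 'a \<Rightarrow> ennreal" where
  "killed K y f x = indicator (- {y}) x * (\<integral>\<^sup>+z. f z \<partial>measure_pmf (K x))"

text \<open>The \<open>n\<close>-th summand is \<open>1\<close> if \<open>y\<close> is avoided up to
  and including time \<open>n\<close>, and \<open>0\<close> otherwise, so the sum counts the times
  before the first visit.\<close>

lemma hitting_time_eq_suminf:
  "hitting_time y \<omega> = (\<Sum>n. \<Prod>k\<le>n. indicator (- {y}) (\<omega> k))"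
proof (cases "\<exists>n. \<omega> n = y")
  \<comment> \<open>Without a visit every summand is \<open>1\<close>, and the infimum over the
    empty set is infinite.\<close>
  case False
  then have "(\<Prod>k\<le>n. indicator (- {y}) (\<omega> k)) = (1 :: ennreal)" for n
    by (intro prod.neutral) auto
  moreover have "(\<Sum>n. 1 :: ennreal) = \<infinity>"
    by (simp add: suminf_eq_SUP ennreal_SUP_of_nat_eq_top)
  ultimately show ?thesis
    using False by (simp add: hitting_time_def)
next
  case True
  define N where "N = (LEAST n. \<omega> n = y)"
  have N: "\<omega> N = y"
    unfolding N_def using True by (rule LeastI_ex)
  have less: "\<omega> k \<noteq> y" if "k < N" for k
    using not_less_Least[of k "\<lambda>n. \<omega> n = y"] that by (auto simp: N_def)
  have "(\<Prod>k\<le>n. indicator (- {y}) (\<omega> k)) = (if n < N then 1 else 0 :: ennreal)" for n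
  proof (cases "n < N")
    case True
    then show ?thesis
      using less by (auto intro!: prod.neutral simp: indicator_def)
  next
    case False
    then show ?thesis
      using N by (auto intro!: prod_zero bexI[of _ N])
  qed
  then have "(\<Sum>n. \<Prod>k\<le>n. indicator (- {y}) (\<omega> k)) = (\<Sum>n. if n < N then 1 else 0 :: ennreal)"
    by simp
  also have "\<dots> = (\<Sum>n<N. if n < N then 1 else 0)"
    by (rule suminf_finite) auto
  also have "\<dots> = of_nat N"
    by simp
  also have "\<dots> = hitting_time y \<omega>"
    unfolding hitting_time_def
  proof (rule antisym)
    show "of_nat N \<le> (INF n\<in>{n. \<omega> n = y}. of_nat n :: ennreal)"
      by (rule INF_greatest) (use less in \<open>force simp: not_less[symmetric]\<close>)
    show "(INF n\<in>{n. \<omega> n = y}. of_nat n :: ennreal) \<le> of_nat N"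
      by (rule INF_lower) (simp add: N)
  qed
  finally show ?thesis ..
qed

text \<open>\<open>P x (Suc n)\<close> is the joint law of the coordinates \<open>0\<close> to
  \<open>n\<close>. Integrating out the last coordinate replaces \<open>f\<close> by
  \<open>killed K y f\<close>, which is why the induction generalises over \<open>f\<close>.\<close>

lemma nn_integral_markov_step_killed:
  fixes K :: "'a \<Rightarrow> 'a pmf"
  defines "P \<equiv> \<lambda>x. Ionescu_Tulcea.C (markov_step K x) (\<lambda>_. count_space UNIV) 0"
  shows "(\<integral>\<^sup>+\<omega>. (\<Prod>k<n. indicator (- {y}) (\<omega> k)) * f (\<omega> n) \<partial>P x (Suc n) (\<lambda>_. undefined)) =
         (killed K y ^^ n) f x"
proof (induction n arbitrary: f)
  interpret Ionescu_Tulcea "markov_step K x" "\<lambda>_. count_space UNIV"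
    by (rule Ionescu_Tulcea_markov_step)
  have [simp]: "(\<lambda>_. undefined) \<in> space (PiM {0..<0::nat} (\<lambda>_. count_space (UNIV::'a set)))"
    by (simp add: space_PiM)
  {
    \<comment> \<open>The law of \<open>Suc n\<close> coordinates is the law of the first
      \<open>n\<close> bound to one more kernel, so the integral over the last coordinate can be
      taken inside.\<close>
    fix n and g :: "(nat \<Rightarrow> 'a) \<Rightarrow> ennreal"
    assume g: "g \<in> borel_measurable (PiM {0..<Suc n} (\<lambda>_. count_space UNIV))"
    have "(\<integral>\<^sup>+\<omega>. g \<omega> \<partial>C 0 (Suc n) (\<lambda>_. undefined)) =
          (\<integral>\<^sup>+\<omega>. \<integral>\<^sup>+z. g z \<partial>eP n \<omega> \<partial>C 0 n (\<lambda>_. undefined))"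
      unfolding C.simps add_0
      by (rule nn_integral_bind[OF g])
         (use measurable_eP[of n] in \<open>simp add: measurable_cong_sets[OF sets_C]\<close>)
    also have "\<dots> = (\<integral>\<^sup>+\<omega>. \<integral>\<^sup>+z. g (fun_upd \<omega> n z) \<partial>markov_step K x n \<omega> \<partial>C 0 n (\<lambda>_. undefined))"
      by (intro nn_integral_cong) (simp add: nn_integral_eP g space_C)
    finally have "(\<integral>\<^sup>+\<omega>. g \<omega> \<partial>C 0 (Suc n) (\<lambda>_. undefined)) = \<dots>" .
  }
  note last = this
  have meas: "(\<lambda>\<omega>. (\<Prod>k<n. indicator (- {y}) (\<omega> k)) * f (\<omega> n))
      \<in> borel_measurable (PiM {0..<Suc n} (\<lambda>_. count_space UNIV))" for n and f :: "'a \<Rightarrow> ennreal"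
    by (intro borel_measurable_times_ennreal borel_measurable_prod_ennreal
          measurable_compose[OF measurable_component_singleton, where g = f]
          measurable_compose[OF measurable_component_singleton, where g = "indicator (- {y})"]) auto
  {
    case 0
    show ?case
      unfolding P_def by (subst last[OF meas]) (simp add: nn_integral_return markov_step_def)
  next
    case (Suc n)
    have "(\<integral>\<^sup>+\<omega>. (\<Prod>k<Suc n. indicator (- {y}) (\<omega> k)) * f (\<omega> (Suc n)) \<partial>P x (Suc (Suc n)) (\<lambda>_. undefined)) =
        (\<integral>\<^sup>+\<omega>. \<integral>\<^sup>+z. (\<Prod>k<Suc n. indicator (- {y}) (\<omega> k)) * f z \<partial>K (\<omega> n) \<partial>P x (Suc n) (\<lambda>_. undefined))"
      unfolding P_def by (subst last[OF meas]) (simp add: markov_step_def)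
    \<comment> \<open>The avoidance factor of coordinate \<open>n\<close> joins the inner integral;
      together they form \<open>killed K y f\<close> at that coordinate.\<close>
    also have "\<dots> = (\<integral>\<^sup>+\<omega>. (\<Prod>k<n. indicator (- {y}) (\<omega> k)) * killed K y f (\<omega> n) \<partial>P x (Suc n) (\<lambda>_. undefined))"
      by (intro nn_integral_cong) (simp add: nn_integral_cmult killed_def mult.assoc)
    also have "\<dots> = (killed K y ^^ Suc n) f x"
      by (simp only: Suc.IH funpow_Suc_right o_apply)
    finally show ?case .
  }
qed

text \<open>Sum and expectation are exchanged. The \<open>n\<close>-th summand depends on the
  coordinates \<open>0\<close> to \<open>n\<close> only, so its integral is computed under their
  finite-dimensional law.\<close>

lemma nn_integral_hitting_time:
  fixes K :: "'a \<Rightarrow> 'a pmf"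
  shows "(\<integral>\<^sup>+\<omega>. hitting_time y \<omega> \<partial>markov_chain K x) =
    (\<Sum>n. (killed K y ^^ n) (indicator (- {y})) x)"
proof -
  interpret Ionescu_Tulcea "markov_step K x" "\<lambda>_. count_space UNIV"
    by (rule Ionescu_Tulcea_markov_step)
  define g :: "nat \<Rightarrow> (nat \<Rightarrow> 'a) \<Rightarrow> ennreal" where
    "g n \<omega> = (\<Prod>k\<le>n. indicator (- {y}) (\<omega> k))" for n \<omega>
  have meas: "g n \<in> borel_measurable (PiM I (\<lambda>_. count_space UNIV))" if "{..n} \<subseteq> I" for n I
    unfolding g_def
    by (intro borel_measurable_prod_ennreal 
          measurable_compose[OF measurable_component_singleton, where g = "indicator (- {y})"])
       (use that in auto)
  have sets_lim: "sets (markov_chain K x) = sets (PiM UNIV (\<lambda>_. count_space UNIV))"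
    unfolding markov_chain_def by simp
  have "(\<integral>\<^sup>+\<omega>. hitting_time y \<omega> \<partial>markov_chain K x) = (\<Sum>n. \<integral>\<^sup>+\<omega>. g n \<omega> \<partial>markov_chain K x)"
    unfolding hitting_time_eq_suminf g_def[symmetric]
    by (rule nn_integral_suminf) (simp add: measurable_cong_sets[OF sets_lim] meas)
  moreover have "(\<integral>\<^sup>+\<omega>. g n \<omega> \<partial>markov_chain K x) = (killed K y ^^ n) (indicator (- {y})) x" for n
  proof -
    let ?J = "{0..<Suc n}" and ?M = "\<lambda>_. count_space (UNIV :: 'a set)"
    have sets_C': "sets (C 0 (Suc n) (\<lambda>_. undefined)) = sets (PiM {..n} ?M)"
      using sets_C[of "\<lambda>_. undefined" 0 "Suc n"]
      by (simp add: space_PiM atLeast0LessThan lessThan_Suc_atMost del: C.simps)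
    \<comment> \<open>\<open>CI ?J\<close> is the marginal on \<open>?J\<close> of the law of the
      first \<open>up_to ?J\<close> coordinates; these are exactly the coordinates in
      \<open>?J\<close>.\<close>
    have "up_to ?J = Suc n"
      unfolding up_to_def by (rule Least_equality) (auto simp: not_less_eq_eq[symmetric])
    have "(\<integral>\<^sup>+\<omega>. g n \<omega> \<partial>markov_chain K x) = (\<integral>\<^sup>+\<omega>. g n (restrict \<omega> ?J) \<partial>markov_chain K x)"
      by (intro nn_integral_cong) (auto simp: g_def intro!: prod.cong)
    also have "\<dots> = (\<integral>\<^sup>+\<omega>. g n \<omega> \<partial>CI ?J)"
      unfolding distr_markov_chain[OF finite_atLeastLessThan, symmetric]
      by (rule nn_integral_distr[symmetric])
         (simp_all only: measurable_cong_sets[OF sets_lim refl] measurable_distr_eq1 meas atLeast0LessThan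
            lessThan_Suc_atMost measurable_restrict_subset subset_UNIV order_refl)
    also have "\<dots> = (\<integral>\<^sup>+\<omega>. g n (restrict \<omega> ?J) \<partial>C 0 (Suc n) (\<lambda>_. undefined))"
      unfolding CI_def \<open>up_to ?J = Suc n\<close>
      by (rule nn_integral_distr)
         (simp_all only: measurable_cong_sets[OF sets_C' refl] measurable_distr_eq1 meas atLeast0LessThan
            lessThan_Suc_atMost measurable_restrict_subset order_refl)
    also have "\<dots> = (\<integral>\<^sup>+\<omega>. (\<Prod>k<n. indicator (- {y}) (\<omega> k)) * indicator (- {y}) (\<omega> n)
        \<partial>C 0 (Suc n) (\<lambda>_. undefined))"
      by (intro nn_integral_cong) (auto simp: g_def lessThan_Suc_atMost[symmetric] intro!: prod.cong)
    also have "\<dots> = (killed K y ^^ n) (indicator (- {y})) x"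
      by (rule nn_integral_markov_step_killed)
    finally show ?thesis .
  qed
  ultimately show ?thesis
    by simp
qed

section \<open>Comparison of chains through couplings\<close>

lemma rel_pmf_nn_integral_mono:
  assumes "rel_pmf R p q" and "\<And>a b. R a b \<Longrightarrow> f a \<le> g b"
  shows "(\<integral>\<^sup>+a. f a \<partial>measure_pmf p) \<le> (\<integral>\<^sup>+b. g b \<partial>measure_pmf q)"
  using assms(1)
proof cases
  case (1 pq)
  have "(\<integral>\<^sup>+a. f a \<partial>measure_pmf p) = (\<integral>\<^sup>+z. f (fst z) \<partial>measure_pmf pq)"
    unfolding 1(2)[symmetric] by simp
  also have "\<dots> \<le> (\<integral>\<^sup>+z. g (snd z) \<partial>measure_pmf pq)"
    by (intro nn_integral_mono_AE) (auto simp: AE_measure_pmf_iff intro!: assms(2) 1)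
  also have "\<dots> = (\<integral>\<^sup>+b. g b \<partial>measure_pmf q)"
    unfolding 1(3)[symmetric] by simp
  finally show ?thesis .
qed

text \<open>The one-step couplings give, by induction on \<open>n\<close>, that avoiding
  \<open>y\<close> up to time \<open>n\<close> from \<open>a\<close> is at most as likely as
  avoiding \<open>y'\<close> from \<open>b\<close> whenever \<open>R a b\<close>. By the last
  assumption the first chain is at \<open>y\<close> when the second is at \<open>y'\<close>. Summing
  over \<open>n\<close> compares the expectations.\<close>

lemma nn_integral_hitting_time_mono:
  assumes "R x s"
    and "\<And>a b. R a b \<Longrightarrow> rel_pmf R (K a) (K' b)"
    and "\<And>a. R a y' \<Longrightarrow> a = y"
  shows "(\<integral>\<^sup>+\<omega>. hitting_time y \<omega> \<partial>markov_chain K x) \<le>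
         (\<integral>\<^sup>+\<omega>. hitting_time y' \<omega> \<partial>markov_chain K' s)"
proof -
  have ind: "indicator (- {y}) a \<le> (indicator (- {y'}) b :: ennreal)" if "R a b" for a b
    using assms(3) that by (auto simp: indicator_def)
  have "(killed K y ^^ n) (indicator (- {y})) a \<le> (killed K' y' ^^ n) (indicator (- {y'})) b"
    if "R a b" for n a b
    using that
  proof (induction n arbitrary: a b)
    case 0
    then show ?case
      by (simp add: ind)
  next
    case (Suc n)
    show ?case
      unfolding funpow.simps o_apply killed_def[of _ _ _ a] killed_def[of _ _ _ b]
      by (intro mult_mono ind Suc.prems rel_pmf_nn_integral_mono[OF assms(2)] Suc.IH) auto
  qed
  then show ?thesis
    unfolding nn_integral_hitting_time using assms(1) by (intro suminf_le) auto
qed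

text \<open>As \<open>h\<close> is injective, the coins at \<open>h t\<close> and the coins at
  \<open>t\<close>, for \<open>t\<close> in \<open>B'\<close>, are both independent families with
  law \<open>q\<close>. They are thus equal in law and can be coupled to be equal.\<close>

lemma rel_pmf_Pi_pmf_inj_on:
  assumes fin: "finite A" "finite B" and sub: "B' \<subseteq> B" "h ` B' \<subseteq> A" and inj: "inj_on h B'"
    and z: "z \<notin> A"
  shows "rel_pmf (\<lambda>f g. \<forall>t\<in>B'. f (h t) = g t) (Pi_pmf A d (\<lambda>_. q)) (Pi_pmf B d (\<lambda>_. q))"
proof -
  define F where "F f = (\<lambda>t. if t \<in> B' then f (h t) else d)" for f :: "'a \<Rightarrow> 'c"
  define G where "G g = (\<lambda>t. if t \<in> B' then g t else d)" for g :: "'b \<Rightarrow> 'c"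
  \<comment> \<open>Points outside \<open>B'\<close> are sent to \<open>z\<close>, which is not in
    \<open>A\<close>, so that the coin read there has the default value \<open>d\<close>.\<close>
  define h' where "h' t = (if t \<in> B' then h t else z)" for t
  have "finite B'"
    using fin(2) sub(1) by (rule finite_subset[rotated])
  have "bij_betw h' B' (h ` B')"
    using inj unfolding bij_betw_def by (auto simp: h'_def inj_on_def)
  then have "Pi_pmf B' d (\<lambda>_. q) = map_pmf (\<lambda>f. f \<circ> h') (Pi_pmf (h ` B') d (\<lambda>_. q))"
    by (rule Pi_pmf_bij_betw[OF \<open>finite B'\<close>]) (use z sub(2) in \<open>auto simp: h'_def\<close>)
  also have "\<dots> = map_pmf ((\<lambda>f. f \<circ> h') \<circ> (\<lambda>f y. if y \<in> h ` B' then f y else d)) (Pi_pmf A d (\<lambda>_. q))"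
    unfolding Pi_pmf_subset[OF fin(1) sub(2)] by (simp add: pmf.map_comp)
  also have "(\<lambda>f. f \<circ> h') \<circ> (\<lambda>f y. if y \<in> h ` B' then f y else d) = F"
    using z sub(2) by (auto simp: F_def h'_def fun_eq_iff)
  finally have "map_pmf F (Pi_pmf A d (\<lambda>_. q)) = map_pmf G (Pi_pmf B d (\<lambda>_. q))"
    unfolding G_def[abs_def] Pi_pmf_subset[OF fin(2) sub(1), symmetric] by simp
  \<comment> \<open>Equal laws of the images \<open>F f\<close> and \<open>G g\<close> are coupled
    by equality, and this lifts to a coupling of \<open>f\<close> and \<open>g\<close>
    themselves.\<close>
  then have "rel_pmf (=) (map_pmf F (Pi_pmf A d (\<lambda>_. q))) (map_pmf G (Pi_pmf B d (\<lambda>_. q)))"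
    by (simp add: pmf.rel_eq)
  then have "rel_pmf (\<lambda>f g. F f = G g) (Pi_pmf A d (\<lambda>_. q)) (Pi_pmf B d (\<lambda>_. q))"
    by (simp add: pmf.rel_map)
  then show ?thesis
    by (rule pmf.rel_mono_strong) (auto simp: F_def G_def fun_eq_iff split: if_splits)
qed


section \<open>Irreducibles and longest chains\<close>

lemma (in partial_order) chain_of_iff:
  "chain_of L C \<longleftrightarrow> C \<subseteq> carrier L \<and> (\<forall>x\<in>C. \<forall>y\<in>C. x \<sqsubseteq> y \<or> y \<sqsubseteq> x)"
proof -
  have "x \<sqsubset> y \<or> x = y \<longleftrightarrow> x \<sqsubseteq> y" if "x \<in> carrier L" for x y
    using that by (auto simp: lless_eq)
  then show ?thesis
    unfolding pred_on.chain_def by (simp cong: conj_cong add: subset_iff)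
qed

lemma (in partial_order) obtain_minimal:
  assumes "finite A" "A \<subseteq> carrier L" "A \<noteq> {}"
  obtains a where "a \<in> A" "\<And>b. b \<in> A \<Longrightarrow> b \<sqsubseteq> a \<Longrightarrow> b = a"
proof -
  have "\<exists>a\<in>A. \<forall>b\<in>A. b \<sqsubseteq> a \<longrightarrow> b = a"
    using assms(1,3,2)
  proof (induction A rule: finite_ne_induct)
    case (singleton x)
    then show ?case by simp
  next
    case (insert x F)
    then obtain a where a: "a \<in> F" "\<forall>b\<in>F. b \<sqsubseteq> a \<longrightarrow> b = a"
      by auto
    show ?case
    proof (cases "x \<sqsubseteq> a")
      case True
      have "b = x" if "b \<in> F" "b \<sqsubseteq> x" for b
      proof -
        have "b \<sqsubseteq> a"
          using le_trans[OF that(2) True] insert.prems a(1) that(1) by auto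
        then have "b = a"
          using a(2) that(1) by blast
        then show ?thesis
          using le_antisym[OF that(2)] True insert.prems a(1) by auto
      qed
      then show ?thesis by auto
    next
      case False
      then show ?thesis using a by auto
    qed
  qed
  then show ?thesis using that by blast
qed

section \<open>Separation of elements by irreducibles\<close>

lemma (in lattice) le_meet_iff:
  assumes "x \<in> carrier L" "y \<in> carrier L" "z \<in> carrier L"
  shows "x \<sqsubseteq> y \<sqinter>\<^bsub>L\<^esub> z \<longleftrightarrow> x \<sqsubseteq> y \<and> x \<sqsubseteq> z"
proof
  assume le: "x \<sqsubseteq> y \<sqinter>\<^bsub>L\<^esub> z"
  show "x \<sqsubseteq> y \<and> x \<sqsubseteq> z"
    using le_trans[OF le meet_left[OF assms(2,3)]] le_trans[OF le meet_right[OF assms(2,3)]] assms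
    by simp
qed (use assms in \<open>simp add: meet_le\<close>)

lemma (in lattice) join_le_iff:
  assumes "x \<in> carrier L" "y \<in> carrier L" "z \<in> carrier L"
  shows "x \<squnion>\<^bsub>L\<^esub> y \<sqsubseteq> z \<longleftrightarrow> x \<sqsubseteq> z \<and> y \<sqsubseteq> z"
proof
  assume le: "x \<squnion>\<^bsub>L\<^esub> y \<sqsubseteq> z"
  show "x \<sqsubseteq> z \<and> y \<sqsubseteq> z"
    using le_trans[OF join_left[OF assms(1,2)] le] le_trans[OF join_right[OF assms(1,2)] le] assms
    by simp
qed (use assms in \<open>simp add: join_le\<close>)

text \<open>Take \<open>j\<close> minimal among the elements below \<open>a\<close> but not below
  \<open>b\<close>. Everything strictly below \<open>j\<close> is then below \<open>b\<close>, so
  the meet of \<open>j\<close> and \<open>b\<close> is the only lower cover of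
  \<open>j\<close>.\<close>

lemma (in lattice) ex_join_irreducible:
  assumes fin: "finite (carrier L)" and ab: "a \<in> carrier L" "b \<in> carrier L" "\<not> a \<sqsubseteq> b"
  shows "\<exists>j\<in>join_irreducibles L. j \<sqsubseteq> a \<and> \<not> j \<sqsubseteq> b"
proof -
  define A where "A = {c \<in> carrier L. c \<sqsubseteq> a \<and> \<not> c \<sqsubseteq> b}"
  have "finite A" "A \<subseteq> carrier L" "A \<noteq> {}"
    using fin ab by (auto simp: A_def)
  then obtain j where j: "j \<in> A" "\<And>c. c \<in> A \<Longrightarrow> c \<sqsubseteq> j \<Longrightarrow> c = j"
    by (rule obtain_minimal) blast
  have jc: "j \<in> carrier L" "j \<sqsubseteq> a" "\<not> j \<sqsubseteq> b"
    using j(1) by (auto simp: A_def)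
  have below: "c \<sqsubseteq> b" if "c \<in> carrier L" "c \<sqsubset> j" for c
  proof (rule ccontr)
    assume "\<not> c \<sqsubseteq> b"
    moreover have "c \<sqsubseteq> a"
      using le_trans[of c j a] that jc ab by (auto simp: lless_eq)
    ultimately have "c = j"
      using j(2)[of c] that by (auto simp: A_def lless_eq)
    then show False using that by (simp add: lless_eq)
  qed
  let ?d = "j \<sqinter>\<^bsub>L\<^esub> b"
  have d: "?d \<in> carrier L" "?d \<sqsubset> j"
    using jc ab meet_left[of j b] meet_right[of j b] by (auto simp: lless_eq)
  have le_d: "c \<sqsubseteq> ?d" if "c \<in> carrier L" "c \<sqsubset> j" for c
    using below[OF that] that jc ab by (simp add: le_meet_iff lless_eq)
  have "?d \<in> lower_covers L j"
    using d le_d by (auto simp: lower_covers_def lless_eq)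
  moreover have "y = ?d" if "y \<in> lower_covers L j" for y
  proof (rule ccontr)
    assume "y \<noteq> ?d"
    with that le_d have "y \<sqsubset> ?d"
      by (auto simp: lower_covers_def lless_eq)
    with that d show False
      by (auto simp: lower_covers_def)
  qed
  ultimately have "j \<in> join_irreducibles L"
    using jc by (auto simp: join_irreducibles_def)
  then show ?thesis using jc by auto
qed

text \<open>Carries the separation by join-irreducibles over to meet-irreducibles by reversing the
  order.\<close>

lemma (in partial_order) join_irreducibles_dual:
  "join_irreducibles (inv_gorder L) = meet_irreducibles L"
proof -
  have "y \<in> lower_covers (inv_gorder L) x \<longleftrightarrow> y \<in> carrier L \<and> x \<in> lower_covers L y"
    if "x \<in> carrier L" for x y
    using that by (auto simp: lower_covers_def lless_def eq_is_equal)
  then show ?thesis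
    by (auto simp: join_irreducibles_def meet_irreducibles_def)
qed

lemma (in lattice) ex_meet_irreducible:
  assumes fin: "finite (carrier L)" and ab: "a \<in> carrier L" "b \<in> carrier L" "\<not> a \<sqsubseteq> b"
  shows "\<exists>m\<in>meet_irreducibles L. b \<sqsubseteq> m \<and> \<not> a \<sqsubseteq> m"
  using lattice.ex_join_irreducible[OF dual_lattice, of b a] assms
  by (simp add: join_irreducibles_dual)

section \<open>Strictly monotone functions on chains\<close>

lemma (in partial_order) inj_on_chain:
  fixes f :: "'a \<Rightarrow> nat"
  assumes "chain_of L C" "\<And>a b. a \<in> C \<Longrightarrow> b \<in> C \<Longrightarrow> a \<sqsubset> b \<Longrightarrow> f a < f b"
  shows "inj_on f C"
proof (rule inj_onI, rule ccontr)
  fix x y assume xy: "x \<in> C" "y \<in> C" "f x = f y" "x \<noteq> y"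
  then have "x \<sqsubset> y \<or> y \<sqsubset> x"
    using assms(1) unfolding chain_of_iff lless_eq by blast
  then show False
    using assms(2)[of x y] assms(2)[of y x] xy by auto
qed

lemma (in partial_order) card_below_chain_le:
  fixes f :: "'a \<Rightarrow> nat"
  assumes "chain_of L C" "c \<in> C" "\<And>a b. a \<in> C \<Longrightarrow> b \<in> C \<Longrightarrow> a \<sqsubset> b \<Longrightarrow> f a < f b"
  shows "card {a \<in> C. a \<sqsubset> c} \<le> f c"
proof -
  have "inj_on f C"
    using assms(1,3) by (rule inj_on_chain)
  then have "card {a \<in> C. a \<sqsubset> c} = card (f ` {a \<in> C. a \<sqsubset> c})"
    by (intro card_image[symmetric]) (auto elim: inj_on_subset)
  also have "\<dots> \<le> card {..<f c}"
    using assms(2,3) by (intro card_mono) auto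
  finally show ?thesis by simp
qed

lemma (in partial_order) card_above_chain_le:
  fixes f :: "'a \<Rightarrow> nat"
  assumes "chain_of L C" "c \<in> C" "\<And>a b. a \<in> C \<Longrightarrow> b \<in> C \<Longrightarrow> a \<sqsubset> b \<Longrightarrow> f a < f b"
    and "\<And>a. a \<in> C \<Longrightarrow> f a \<le> n"
  shows "f c + card {a \<in> C. c \<sqsubset> a} \<le> n"
proof -
  have "inj_on f C"
    using assms(1,3) by (rule inj_on_chain)
  then have "card {a \<in> C. c \<sqsubset> a} = card (f ` {a \<in> C. c \<sqsubset> a})"
    by (intro card_image[symmetric]) (auto elim: inj_on_subset)
  also have "\<dots> \<le> card {f c<..n}"
    using assms(2-4) by (intro card_mono) auto
  finally show ?thesis using assms(4)[OF assms(2)] by simp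
qed

lemma (in partial_order) card_chain_split:
  assumes "chain_of L C" "c \<in> C" "finite C"
  shows "card C = card {a \<in> C. a \<sqsubset> c} + card {a \<in> C. c \<sqsubset> a} + 1"
proof -
  have "C = insert c ({a \<in> C. a \<sqsubset> c} \<union> {a \<in> C. c \<sqsubset> a})"
    using assms(1,2) unfolding chain_of_iff lless_eq by blast
  also have "card \<dots> = Suc (card ({a \<in> C. a \<sqsubset> c} \<union> {a \<in> C. c \<sqsubset> a}))"
    using assms(3) by (intro card_insert_disjoint) (auto simp: lless_eq)
  also have "card ({a \<in> C. a \<sqsubset> c} \<union> {a \<in> C. c \<sqsubset> a}) = card {a \<in> C. a \<sqsubset> c} + card {a \<in> C. c \<sqsubset> a}"
    using assms by (intro card_Un_disjoint) (auto simp: lless_eq chain_of_iff)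
  finally show ?thesis by simp
qed

text \<open>The value \<open>f c\<close> is at least the number of elements below \<open>c\<close>
  and at most \<open>n\<close> minus the number above. On a chain with \<open>Suc n\<close> elements
  the two bounds coincide.\<close>

lemma (in partial_order) strict_mono_on_chain_eq_rank:
  fixes f :: "'a \<Rightarrow> nat"
  assumes "chain_of L C" "c \<in> C" "finite C" "card C = Suc n"
    and "\<And>a b. a \<in> C \<Longrightarrow> b \<in> C \<Longrightarrow> a \<sqsubset> b \<Longrightarrow> f a < f b"
    and "\<And>a. a \<in> C \<Longrightarrow> f a \<le> n"
  shows "f c = card {a \<in> C. a \<sqsubset> c}"
proof -
  have "card {a \<in> C. a \<sqsubset> c} \<le> f c"
    using assms(1,2,5) by (rule card_below_chain_le)
  moreover have "f c + card {a \<in> C. c \<sqsubset> a} \<le> n"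
    using assms(1,2,5,6) by (rule card_above_chain_le)
  ultimately show ?thesis
    using card_chain_split[OF assms(1-3)] assms(4) by simp
qed


section \<open>Extremal lattices and their longest chains\<close>

locale extremal_lattice = lattice L for L (structure) +
  assumes finite_carrier: "finite (carrier L)"
    and carrier_nonempty: "carrier L \<noteq> {}"
    and extremal: "extremal L"
begin

abbreviation "n \<equiv> lattice_length L"

definition jis :: "'a \<Rightarrow> 'a set" where
  "jis a = {j \<in> join_irreducibles L. j \<sqsubseteq> a}"

definition mis :: "'a \<Rightarrow> 'a set" where
  "mis a = {m \<in> meet_irreducibles L. a \<sqsubseteq> m}"

lemma join_irreducibles_subset: "join_irreducibles L \<subseteq> carrier L"
  by (auto simp: join_irreducibles_def)

lemma meet_irreducibles_subset: "meet_irreducibles L \<subseteq> carrier L"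
  by (auto simp: meet_irreducibles_def)

lemma finite_irreducibles:
  "finite (join_irreducibles L)" "finite (meet_irreducibles L)"
  using finite_subset[OF _ finite_carrier] join_irreducibles_subset meet_irreducibles_subset by auto

lemma finite_jis: "finite (jis a)" and finite_mis: "finite (mis a)"
  using finite_irreducibles by (auto simp: jis_def mis_def)

lemma card_jis_le: "card (jis a) \<le> n" and card_mis_le: "card (mis a) \<le> n"
  using extremal card_mono[OF finite_irreducibles(1), of "jis a"]
    card_mono[OF finite_irreducibles(2), of "mis a"]
  by (auto simp: extremal_def jis_def mis_def)

lemma jis_subset_iff:
  assumes "a \<in> carrier L" "b \<in> carrier L"
  shows "jis a \<subseteq> jis b \<longleftrightarrow> a \<sqsubseteq> b"
proof
  assume "jis a \<subseteq> jis b"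
  then show "a \<sqsubseteq> b"
    using ex_join_irreducible[OF finite_carrier assms] unfolding jis_def by blast
next
  assume "a \<sqsubseteq> b"
  then show "jis a \<subseteq> jis b"
    using assms join_irreducibles_subset unfolding jis_def by (blast intro: le_trans)
qed

lemma mis_subset_iff:
  assumes "a \<in> carrier L" "b \<in> carrier L"
  shows "mis b \<subseteq> mis a \<longleftrightarrow> a \<sqsubseteq> b"
proof
  assume "mis b \<subseteq> mis a"
  then show "a \<sqsubseteq> b"
    using ex_meet_irreducible[OF finite_carrier assms] unfolding mis_def by blast
next
  assume "a \<sqsubseteq> b"
  then show "mis b \<subseteq> mis a"
    using assms meet_irreducibles_subset unfolding mis_def by (blast intro: le_trans)
qed

lemma card_jis_less:
  assumes "a \<in> carrier L" "b \<in> carrier L" "a \<sqsubset> b"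
  shows "card (jis a) < card (jis b)"
proof -
  have "jis a \<subset> jis b"
    using jis_subset_iff[of a b] jis_subset_iff[of b a] assms by (auto simp: lless_eq)
  then show ?thesis
    using finite_jis by (rule psubset_card_mono[rotated])
qed

lemma card_mis_less:
  assumes "a \<in> carrier L" "b \<in> carrier L" "a \<sqsubset> b"
  shows "card (mis b) < card (mis a)"
proof -
  have "mis b \<subset> mis a"
    using mis_subset_iff[of a b] mis_subset_iff[of b a] assms by (auto simp: lless_eq)
  then show ?thesis
    using finite_mis by (rule psubset_card_mono[rotated])
qed

lemma finite_chain_lengths: "finite {card C - 1 | C. chain_of L C \<and> C \<noteq> {}}"
proof -
  have "{card C - 1 | C. chain_of L C \<and> C \<noteq> {}} \<subseteq> (\<lambda>C. card C - 1) ` Pow (carrier L)"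
    by (auto simp: chain_of_iff)
  then show ?thesis
    by (rule finite_subset) (simp add: finite_carrier)
qed

lemma finite_chain: "chain_of L C \<Longrightarrow> finite C"
  using finite_subset[OF _ finite_carrier] by (auto simp: chain_of_iff)

lemma card_chain_le:
  assumes "chain_of L C"
  shows "card C \<le> Suc n"
proof (cases "C = {}")
  case False
  then have "card C - 1 \<le> n"
    unfolding lattice_length_def using assms by (intro Max_ge[OF finite_chain_lengths]) auto
  then show ?thesis by simp
qed simp

text \<open>Truncated subtraction also gives the empty chain length \<open>0\<close>, which matters
  when \<open>n = 0\<close>; the form \<open>Suc n\<close> excludes it.\<close>

lemma longest_chain_iff:
  "C \<noteq> {} \<and> card C - 1 = n \<longleftrightarrow> card C = Suc n" if "chain_of L C" for C
  using finite_chain[OF that] by (cases "card C") auto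

lemma spine_set_eq: "spine_set L = {x. \<exists>C. chain_of L C \<and> card C = Suc n \<and> x \<in> C}"
  unfolding spine_set_def using longest_chain_iff by blast

lemma obtain_longest_chain:
  obtains C where "chain_of L C" "card C = Suc n"
proof -
  obtain a where "a \<in> carrier L"
    using carrier_nonempty by blast
  then have "chain_of L {a}"
    by (simp add: chain_of_iff)
  then have "{card C - 1 | C. chain_of L C \<and> C \<noteq> {}} \<noteq> {}"
    by blast
  then have "n \<in> {card C - 1 | C. chain_of L C \<and> C \<noteq> {}}"
    unfolding lattice_length_def by (rule Max_in[OF finite_chain_lengths])
  then obtain C where C: "n = card C - 1" "chain_of L C" "C \<noteq> {}"
    by (elim CollectE exE conjE)
  then have "card C = Suc n"
    using longest_chain_iff[OF C(2)] by metis
  with C(2) show ?thesis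
    by (rule that)
qed

text \<open>Along a chain, \<open>card (jis c)\<close> strictly increases and
  \<open>card (mis c)\<close> strictly decreases, and extremality bounds both by \<open>n\<close>.
  On a chain with \<open>Suc n\<close> elements this leaves no freedom.\<close>

lemma
  assumes C: "chain_of L C" "card C = Suc n" and c: "c \<in> C"
  shows card_jis_longest_chain: "card (jis c) = card {a \<in> C. a \<sqsubset> c}"
    and card_mis_longest_chain: "card (mis c) = n - card {a \<in> C. a \<sqsubset> c}"
proof -
  have sub: "C \<subseteq> carrier L"
    using C(1) by (simp add: chain_of_iff)
  show "card (jis c) = card {a \<in> C. a \<sqsubset> c}"
    by (rule strict_mono_on_chain_eq_rank[OF C(1) c finite_chain[OF C(1)] C(2)])
       (use sub in \<open>auto intro: card_jis_less card_jis_le\<close>)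
  have "n - card (mis c) = card {a \<in> C. a \<sqsubset> c}"
  proof (rule strict_mono_on_chain_eq_rank[OF C(1) c finite_chain[OF C(1)] C(2)])
    fix a b assume "a \<in> C" "b \<in> C" "a \<sqsubset> b"
    then have "card (mis b) < card (mis a)"
      using sub card_mis_less by blast
    then show "n - card (mis a) < n - card (mis b)"
      using card_mis_le[of a] by linarith
  qed auto
  then show "card (mis c) = n - card {a \<in> C. a \<sqsubset> c}"
    using card_mis_le[of c] by simp
qed

lemma card_jis_mis_spine:
  assumes "s \<in> spine_set L"
  shows "card (jis s) + card (mis s) = n"
proof -
  obtain C where C: "chain_of L C" "card C = Suc n" "s \<in> C"
    using assms by (auto simp: spine_set_eq)
  show ?thesis
    using card_jis_longest_chain[OF C] card_mis_longest_chain[OF C] card_jis_le[of s] by simp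
qed

lemma spine_set_subset: "spine_set L \<subseteq> carrier L"
  by (auto simp: spine_set_eq chain_of_iff)

text \<open>One longest chain is fixed and \<open>x l\<close> is its element of rank
  \<open>l\<close>. The step from \<open>x (k - 1)\<close> to \<open>x k\<close> gains the single
  join-irreducible \<open>ji k\<close> and loses the single meet-irreducible \<open>mi k\<close>; by
  extremality these exhaust all irreducibles.\<close>

lemma ex_labelling:
  obtains x :: "nat \<Rightarrow> 'a" and ji mi :: "nat \<Rightarrow> 'a" where
    "\<And>l. l \<le> n \<Longrightarrow> x l \<in> carrier L"
    "bij_betw ji {1..n} (join_irreducibles L)"
    "bij_betw mi {1..n} (meet_irreducibles L)"
    "\<And>k l. k \<in> {1..n} \<Longrightarrow> l \<le> n \<Longrightarrow> ji k \<sqsubseteq> x l \<longleftrightarrow> k \<le> l"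
    "\<And>k l. k \<in> {1..n} \<Longrightarrow> l \<le> n \<Longrightarrow> x l \<sqsubseteq> mi k \<longleftrightarrow> l < k"
    "\<And>k. k \<in> {1..n} \<Longrightarrow> \<not> ji k \<sqsubseteq> mi k"
proof -
  obtain C where C: "chain_of L C" "card C = Suc n"
    by (rule obtain_longest_chain)
  have sub: "C \<subseteq> carrier L" and total: "\<And>a b. a \<in> C \<Longrightarrow> b \<in> C \<Longrightarrow> a \<sqsubseteq> b \<or> b \<sqsubseteq> a"
    using C(1) by (auto simp: chain_of_iff)
  let ?r = "\<lambda>c. card (jis c)"
  have "inj_on ?r C"
    using C(1) by (rule inj_on_chain) (use sub in \<open>auto intro: card_jis_less\<close>)
  moreover have "?r ` C \<subseteq> {..n}"
    using card_jis_le by auto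
  \<comment> \<open>The ranks of the \<open>Suc n\<close> elements are distinct and lie in
    \<open>{..n}\<close>, so every rank occurs exactly once.\<close>
  ultimately have "?r ` C = {..n}"
    using C(2) by (intro card_subset_eq) (auto simp: card_image)
  then have in_r: "l \<in> ?r ` C" if "l \<le> n" for l
    using that by simp
  define x where "x = inv_into C ?r"
  have x: "x l \<in> C" "?r (x l) = l" if "l \<le> n" for l
    using inv_into_into[OF in_r[OF that]] f_inv_into_f[OF in_r[OF that]] by (simp_all add: x_def)
  have xc: "x l \<in> carrier L" if "l \<le> n" for l
    using x(1)[OF that] sub by blast
  have r_mis: "card (mis (x l)) = n - l" if "l \<le> n" for l
    using card_jis_longest_chain[OF C x(1)[OF that]] card_mis_longest_chain[OF C x(1)[OF that]]
      x(2)[OF that] by simp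
  have x_mono: "x k \<sqsubseteq> x l" if "k \<le> l" "l \<le> n" for k l
  proof (rule ccontr)
    assume "\<not> x k \<sqsubseteq> x l"
    moreover have "x k \<in> C" "x l \<in> C"
      using x(1) that by auto
    ultimately have "x l \<sqsubset> x k"
      using total[of "x k" "x l"] sub by (auto simp: lless_eq)
    then have "l < k"
      using card_jis_less[of "x l" "x k"] x(2)[of l] x(2)[of k] xc[of l] xc[of k] that by simp
    then show False using that by simp
  qed
  \<comment> \<open>The set is a singleton for \<open>k\<close> in \<open>{1..n}\<close>, because
    the two nested sets have \<open>k\<close> and \<open>k - 1\<close> elements.\<close>
  define ji where "ji k = the_elem (jis (x k) - jis (x (k - 1)))" for k
  have ji: "jis (x k) - jis (x (k - 1)) = {ji k}" if "k \<in> {1..n}" for k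
  proof -
    have "jis (x (k - 1)) \<subseteq> jis (x k)"
      using that by (subst jis_subset_iff) (auto intro: xc x_mono)
    then have "card (jis (x k) - jis (x (k - 1))) = k - (k - 1)"
      using that x(2)[of k] x(2)[of "k - 1"] by (subst card_Diff_subset) (auto intro: finite_jis)
    then show ?thesis
      unfolding ji_def is_singleton_the_elem[symmetric] is_singleton_altdef using that by simp
  qed
  define mi where "mi k = the_elem (mis (x (k - 1)) - mis (x k))" for k
  have mi: "mis (x (k - 1)) - mis (x k) = {mi k}" if "k \<in> {1..n}" for k
  proof -
    have "mis (x k) \<subseteq> mis (x (k - 1))"
      using that by (subst mis_subset_iff) (auto intro: xc x_mono)
    then have "card (mis (x (k - 1)) - mis (x k)) = (n - (k - 1)) - (n - k)"
      using that r_mis[of k] r_mis[of "k - 1"] by (subst card_Diff_subset) (auto intro: finite_mis)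
    then show ?thesis
      unfolding mi_def is_singleton_the_elem[symmetric] is_singleton_altdef using that by simp
  qed
  have ji_in: "ji k \<in> join_irreducibles L" and ji_up: "ji k \<sqsubseteq> x k"
    and ji_low: "\<not> ji k \<sqsubseteq> x (k - 1)" if "k \<in> {1..n}" for k
    using ji[OF that] by (auto simp: jis_def)
  have mi_in: "mi k \<in> meet_irreducibles L" and mi_low: "x (k - 1) \<sqsubseteq> mi k"
    and mi_up: "\<not> x k \<sqsubseteq> mi k" if "k \<in> {1..n}" for k
    using mi[OF that] by (auto simp: mis_def)
  have jic: "ji k \<in> carrier L" and mic: "mi k \<in> carrier L" if "k \<in> {1..n}" for k
    using ji_in[OF that] mi_in[OF that] join_irreducibles_subset meet_irreducibles_subset by auto
  have ji_iff: "ji k \<sqsubseteq> x l \<longleftrightarrow> k \<le> l" if k: "k \<in> {1..n}" and l: "l \<le> n" for k l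
  proof
    assume "k \<le> l"
    then show "ji k \<sqsubseteq> x l"
      using le_trans[OF ji_up[OF k] x_mono[of k l]] k l jic xc by auto
  next
    assume *: "ji k \<sqsubseteq> x l"
    show "k \<le> l"
    proof (rule ccontr)
      assume "\<not> k \<le> l"
      then have "ji k \<sqsubseteq> x (k - 1)"
        using le_trans[OF * x_mono[of l "k - 1"]] k l jic xc by auto
      then show False using ji_low[OF k] by simp
    qed
  qed
  have mi_iff: "x l \<sqsubseteq> mi k \<longleftrightarrow> l < k" if k: "k \<in> {1..n}" and l: "l \<le> n" for k l
  proof
    assume "l < k"
    then show "x l \<sqsubseteq> mi k"
      using le_trans[OF x_mono[of l "k - 1"] mi_low[OF k]] k l mic xc by auto
  next
    assume *: "x l \<sqsubseteq> mi k"
    show "l < k"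
    proof (rule ccontr)
      assume "\<not> l < k"
      then have "x k \<sqsubseteq> mi k"
        using le_trans[OF x_mono[of k l] *] k l mic xc by auto
      then show False using mi_up[OF k] by simp
    qed
  qed
  have "\<not> ji k \<sqsubseteq> mi k" if k: "k \<in> {1..n}" for k
  proof
    assume le: "ji k \<sqsubseteq> mi k"
    \<comment> \<open>This join has all join-irreducibles of \<open>x k\<close> below it, hence
      \<open>x k\<close> itself, yet it would lie below \<open>mi k\<close>.\<close>
    let ?u = "x (k - 1) \<squnion>\<^bsub>L\<^esub> ji k"
    have xk: "x (k - 1) \<in> carrier L" "x k \<in> carrier L"
      using k xc by auto
    have u: "?u \<in> carrier L"
      using xk jic[OF k] by simp
    have "x (k - 1) \<sqsubseteq> ?u" "ji k \<sqsubseteq> ?u"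
      using xk jic[OF k] by (auto intro: join_left join_right)
    then have "jis (x (k - 1)) \<subseteq> jis ?u" "ji k \<in> jis ?u"
      using jis_subset_iff xk u ji_in[OF k] by (auto simp: jis_def)
    moreover have "jis (x k) \<subseteq> insert (ji k) (jis (x (k - 1)))"
      using Diff_subset_conv[of "jis (x k)" "jis (x (k - 1))" "{ji k}"] ji[OF k] by simp
    ultimately have "jis (x k) \<subseteq> jis ?u"
      by blast
    then have "x k \<sqsubseteq> ?u"
      using jis_subset_iff xk u by simp
    moreover have "?u \<sqsubseteq> mi k"
      using join_le_iff xk jic[OF k] mic[OF k] le mi_low[OF k] by simp
    ultimately have "x k \<sqsubseteq> mi k"
      using le_trans xk u mic[OF k] by blast
    then show False using mi_up[OF k] by simp
  qed
  moreover have "bij_betw ji {1..n} (join_irreducibles L)"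
  proof -
    have "inj_on ji {1..n}"
    proof (rule inj_onI)
      fix a b assume "a \<in> {1..n}" "b \<in> {1..n}" "ji a = ji b"
      then show "a = b"
        using ji_iff[of a a] ji_iff[of a b] ji_iff[of b a] ji_iff[of b b] by simp
    qed
    moreover have "ji ` {1..n} = join_irreducibles L"
      using ji_in card_image[OF calculation] extremal
      by (intro card_subset_eq finite_irreducibles) (auto simp: extremal_def)
    ultimately show ?thesis by (simp add: bij_betw_def)
  qed
  moreover have "bij_betw mi {1..n} (meet_irreducibles L)"
  proof -
    have "inj_on mi {1..n}"
    proof (rule inj_onI)
      fix a b assume ab: "a \<in> {1..n}" "b \<in> {1..n}" "mi a = mi b"
      then have "a \<le> n" "b \<le> n" by simp_all
      then have "x a \<sqsubseteq> mi b \<longleftrightarrow> a < b" "\<not> x a \<sqsubseteq> mi a" "x b \<sqsubseteq> mi a \<longleftrightarrow> b < a" "\<not> x b \<sqsubseteq> mi b"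
        using mi_iff ab(1,2) by blast+
      then show "a = b"
        unfolding ab(3) by simp
    qed
    moreover have "mi ` {1..n} = meet_irreducibles L"
      using mi_in card_image[OF calculation] extremal
      by (intro card_subset_eq finite_irreducibles) (auto simp: extremal_def)
    ultimately show ?thesis by (simp add: bij_betw_def)
  qed
  ultimately show ?thesis
    using that[of x ji mi] xc ji_iff mi_iff by blast
qed

end

section \<open>The spine of an extremal lattice\<close>

locale labelled_extremal_lattice = extremal_lattice +
  fixes x ji mi :: "nat \<Rightarrow> 'a"
  assumes x_closed: "l \<le> n \<Longrightarrow> x l \<in> carrier L"
    and ji_bij: "bij_betw ji {1..n} (join_irreducibles L)"
    and mi_bij: "bij_betw mi {1..n} (meet_irreducibles L)"
    and ji_le_x_iff: "k \<in> {1..n} \<Longrightarrow> l \<le> n \<Longrightarrow> ji k \<sqsubseteq> x l \<longleftrightarrow> k \<le> l"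
    and x_le_mi_iff: "k \<in> {1..n} \<Longrightarrow> l \<le> n \<Longrightarrow> x l \<sqsubseteq> mi k \<longleftrightarrow> l < k"
    and not_ji_le_mi: "k \<in> {1..n} \<Longrightarrow> \<not> ji k \<sqsubseteq> mi k"
begin

text \<open>These rules make the classical reasoner loop.\<close>
declare le_cong_l [rule del] le_cong_r [rule del] weak_refl [rule del] weak_le_antisym [rule del]

section \<open>Label sets and split elements\<close>

definition ji_labels :: "'a \<Rightarrow> nat set" where
  "ji_labels a = {k \<in> {1..n}. ji k \<sqsubseteq> a}"

definition mi_labels :: "'a \<Rightarrow> nat set" where
  "mi_labels a = {k \<in> {1..n}. a \<sqsubseteq> mi k}"

lemma ji_closed: "k \<in> {1..n} \<Longrightarrow> ji k \<in> carrier L"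
  using ji_bij join_irreducibles_subset by (auto simp: bij_betw_def)

lemma mi_closed: "k \<in> {1..n} \<Longrightarrow> mi k \<in> carrier L"
  using mi_bij meet_irreducibles_subset by (auto simp: bij_betw_def)

lemma ji_labels_subset: "ji_labels a \<subseteq> {1..n}" and mi_labels_subset: "mi_labels a \<subseteq> {1..n}"
  by (auto simp: ji_labels_def mi_labels_def)

lemma finite_ji_labels: "finite (ji_labels a)" and finite_mi_labels: "finite (mi_labels a)"
  using finite_subset[OF ji_labels_subset] finite_subset[OF mi_labels_subset] by simp_all

lemma jis_eq: "jis a = ji ` ji_labels a"
proof -
  have "join_irreducibles L = ji ` {1..n}"
    using ji_bij by (simp add: bij_betw_def)
  then show ?thesis
    unfolding jis_def ji_labels_def by auto
qed

lemma mis_eq: "mis a = mi ` mi_labels a"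
proof -
  have "meet_irreducibles L = mi ` {1..n}"
    using mi_bij by (simp add: bij_betw_def)
  then show ?thesis
    unfolding mis_def mi_labels_def by auto
qed

lemma card_jis_eq: "card (jis a) = card (ji_labels a)"
  unfolding jis_eq using ji_bij ji_labels_subset
  by (intro card_image) (auto simp: bij_betw_def intro: inj_on_subset)

lemma card_mis_eq: "card (mis a) = card (mi_labels a)"
  unfolding mis_eq using mi_bij mi_labels_subset
  by (intro card_image) (auto simp: bij_betw_def intro: inj_on_subset)

lemma ji_labels_subset_iff:
  assumes "a \<in> carrier L" "b \<in> carrier L"
  shows "ji_labels a \<subseteq> ji_labels b \<longleftrightarrow> a \<sqsubseteq> b"
proof -
  have "jis a \<subseteq> jis b \<longleftrightarrow> ji_labels a \<subseteq> ji_labels b"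
    unfolding jis_eq using ji_bij ji_labels_subset by (intro inj_on_image_subset_iff) (auto simp: bij_betw_def)
  then show ?thesis
    using jis_subset_iff[OF assms] by simp
qed

lemma ji_labels_inj:
  assumes "a \<in> carrier L" "b \<in> carrier L" "ji_labels a = ji_labels b"
  shows "a = b"
  using ji_labels_subset_iff[of a b] ji_labels_subset_iff[of b a] assms by (auto intro: le_antisym)

lemma ji_labels_inter_mi_labels: "a \<in> carrier L \<Longrightarrow> ji_labels a \<inter> mi_labels a = {}"
  using not_ji_le_mi ji_closed mi_closed le_trans[of "ji _" a "mi _"]
  unfolding ji_labels_def mi_labels_def by blast

lemma ji_labels_meet: "a \<in> carrier L \<Longrightarrow> b \<in> carrier L \<Longrightarrow> ji_labels (a \<sqinter>\<^bsub>L\<^esub> b) = ji_labels a \<inter> ji_labels b"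
  using ji_closed by (auto simp: ji_labels_def le_meet_iff)

lemma mi_labels_join: "a \<in> carrier L \<Longrightarrow> b \<in> carrier L \<Longrightarrow> mi_labels (a \<squnion>\<^bsub>L\<^esub> b) = mi_labels a \<inter> mi_labels b"
  using mi_closed by (auto simp: mi_labels_def join_le_iff)

lemma mi_labels_antimono:
  assumes "a \<in> carrier L" "b \<in> carrier L" "a \<sqsubseteq> b"
  shows "mi_labels b \<subseteq> mi_labels a"
  using assms mi_closed by (auto simp: mi_labels_def intro: le_trans)

lemma ji_labels_mono:
  assumes "a \<in> carrier L" "b \<in> carrier L" "a \<sqsubseteq> b"
  shows "ji_labels a \<subseteq> ji_labels b"
  using assms ji_labels_subset_iff by blast

lemma ji_labels_x: "l \<le> n \<Longrightarrow> ji_labels (x l) = {1..l}"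
  using ji_le_x_iff by (auto simp: ji_labels_def)

lemma mi_labels_x: "l \<le> n \<Longrightarrow> mi_labels (x l) = {l<..n}"
  using x_le_mi_iff by (auto simp: mi_labels_def)

text \<open>The description of spine membership by labels. Since the two label sets are disjoint,
  they then partition \<open>{1..n}\<close>.\<close>

definition split_elem :: "'a \<Rightarrow> bool" where
  "split_elem s \<longleftrightarrow> s \<in> carrier L \<and> ji_labels s \<union> mi_labels s = {1..n}"

lemma split_elem_mi_labels: "split_elem s \<Longrightarrow> mi_labels s = {1..n} - ji_labels s"
  using ji_labels_inter_mi_labels[of s] unfolding split_elem_def by blast

lemma split_elem_x: "l \<le> n \<Longrightarrow> split_elem (x l)"
  by (auto simp: split_elem_def ji_labels_x mi_labels_x x_closed)

text \<open>For each label \<open>k\<close>, either \<open>ji k\<close> is below all of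
  \<open>X\<close> and hence below the infimum, or some \<open>s\<close> in \<open>X\<close> is
  below \<open>mi k\<close>, and then so is the infimum.\<close>

lemma split_elem_Inf:
  assumes X: "finite X" "X \<noteq> {}" "\<And>s. s \<in> X \<Longrightarrow> split_elem s"
  shows "split_elem (\<Sqinter>\<^bsub>L\<^esub>X)"
proof -
  have sub: "X \<subseteq> carrier L"
    using X(3) by (auto simp: split_elem_def)
  have m: "greatest L (\<Sqinter>\<^bsub>L\<^esub>X) (Lower L X)"
    using X(1) sub X(2) by (rule finite_inf_greatest)
  have mc: "\<Sqinter>\<^bsub>L\<^esub>X \<in> carrier L"
    using m by (rule greatest_closed)
  have "k \<in> ji_labels (\<Sqinter>\<^bsub>L\<^esub>X) \<union> mi_labels (\<Sqinter>\<^bsub>L\<^esub>X)" if k: "k \<in> {1..n}" for k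
  proof (cases "\<forall>s\<in>X. k \<in> ji_labels s")
    case True
    then have "ji k \<in> Lower L X"
      using ji_closed[OF k] by (auto simp: Lower_def ji_labels_def)
    then have "ji k \<sqsubseteq> \<Sqinter>\<^bsub>L\<^esub>X"
      by (rule greatest_le[OF m])
    then show ?thesis
      using k by (simp add: ji_labels_def)
  next
    case False
    then obtain s where s: "s \<in> X" "k \<notin> ji_labels s"
      by blast
    have "k \<in> mi_labels s"
      using X(3)[OF s(1)] k s(2) unfolding split_elem_def by blast
    moreover have "\<Sqinter>\<^bsub>L\<^esub>X \<sqsubseteq> s"
      using m s(1) sub by (rule greatest_Lower_below)
    ultimately show ?thesis
      using mi_labels_antimono[OF mc, of s] s(1) sub by blast
  qed
  then show ?thesis
    using mc ji_labels_subset mi_labels_subset unfolding split_elem_def by blast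
qed

lemma split_elem_meet: "split_elem s \<Longrightarrow> split_elem t \<Longrightarrow> split_elem (s \<sqinter>\<^bsub>L\<^esub> t)"
  unfolding meet_def by (rule split_elem_Inf) auto

text \<open>The labels in \<open>mi_labels\<close> of a join are the common ones. For split elements
  the two label sets are complementary, which turns this intersection into a union.\<close>

lemma split_elem_join:
  assumes "split_elem s" "split_elem t"
  shows "split_elem (s \<squnion>\<^bsub>L\<^esub> t)" and "ji_labels (s \<squnion>\<^bsub>L\<^esub> t) = ji_labels s \<union> ji_labels t"
proof -
  have c: "s \<in> carrier L" "t \<in> carrier L"
    using assms by (auto simp: split_elem_def)
  have "ji_labels s \<subseteq> ji_labels (s \<squnion>\<^bsub>L\<^esub> t)" "ji_labels t \<subseteq> ji_labels (s \<squnion>\<^bsub>L\<^esub> t)"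
    using c by (simp_all add: ji_labels_mono join_left join_right)
  then show *: "split_elem (s \<squnion>\<^bsub>L\<^esub> t)"
    using assms mi_labels_join[OF c] c ji_labels_subset[of "s \<squnion>\<^bsub>L\<^esub> t"] mi_labels_subset[of "s \<squnion>\<^bsub>L\<^esub> t"]
    unfolding split_elem_def by auto
  show "ji_labels (s \<squnion>\<^bsub>L\<^esub> t) = ji_labels s \<union> ji_labels t"
    using split_elem_mi_labels[OF *] split_elem_mi_labels[OF assms(1)] split_elem_mi_labels[OF assms(2)]
      mi_labels_join[OF c] ji_labels_subset[of "s \<squnion>\<^bsub>L\<^esub> t"] ji_labels_subset[of s] ji_labels_subset[of t]
    by blast
qed

text \<open>The two label sets are disjoint, and their sizes add up to \<open>n\<close> on a longest
  chain, so they cover \<open>{1..n}\<close>.\<close>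

lemma split_elem_spine:
  assumes "s \<in> spine_set L"
  shows "split_elem s"
proof -
  have s: "s \<in> carrier L"
    using assms spine_set_subset by blast
  have "card (ji_labels s \<union> mi_labels s) = n"
    using card_Un_disjoint[OF finite_ji_labels finite_mi_labels ji_labels_inter_mi_labels[OF s]]
      card_jis_mis_spine[OF assms] by (simp add: card_jis_eq card_mis_eq)
  then have "ji_labels s \<union> mi_labels s = {1..n}"
    using ji_labels_subset mi_labels_subset by (intro card_subset_eq) auto
  then show ?thesis
    using s by (simp add: split_elem_def)
qed

text \<open>A longest chain through \<open>s\<close> is obtained from the reference chain \<open>x\<close>: first the meets
  \<open>s \<sqinter> x l\<close>, which move at the steps \<open>l \<in> ji_labels s\<close>, then the joins \<open>s \<squnion> x l\<close>, which move at
  the remaining steps.\<close>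
lemma spine_set_split_elem:
  assumes "split_elem s"
  shows "s \<in> spine_set L"
proof -
  have s: "s \<in> carrier L"
    using assms by (simp add: split_elem_def)
  \<comment> \<open>No irreducible has label \<open>0\<close>; index \<open>0\<close> is put with
    the meets so that the chain starts at the bottom.\<close>
  define y where "y l = (if l \<in> insert 0 (ji_labels s) then s \<sqinter>\<^bsub>L\<^esub> x l else s \<squnion>\<^bsub>L\<^esub> x l)" for l
  define D where "D = insert s (y ` {0..n})"
  have yc: "y l \<in> carrier L" if "l \<le> n" for l
    using s x_closed[OF that] by (simp add: y_def)
  have y_low: "y l \<sqsubseteq> s" "ji_labels (y l) = ji_labels s \<inter> {1..l}" if "l \<le> n" "l \<in> insert 0 (ji_labels s)" for l
    using that s x_closed[of l] ji_labels_meet[of s "x l"] ji_labels_x[of l] by (auto simp: y_def intro: meet_left)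
  have y_high: "s \<sqsubseteq> y l" "ji_labels (y l) = ji_labels s \<union> {1..l}" if "l \<le> n" "l \<notin> insert 0 (ji_labels s)" for l
    using that s x_closed[of l] split_elem_join[OF assms split_elem_x[of l]] ji_labels_x[of l]
    by (auto simp: y_def intro: join_left)
  have comp: "y k \<sqsubseteq> y l \<or> y l \<sqsubseteq> y k" if kl: "k \<le> n" "l \<le> n" for k l
  proof -
    have "ji_labels (y k) \<subseteq> ji_labels (y l) \<or> ji_labels (y l) \<subseteq> ji_labels (y k)"
    proof (cases "k \<in> insert 0 (ji_labels s)"; cases "l \<in> insert 0 (ji_labels s)")
      assume *: "k \<in> insert 0 (ji_labels s)" "l \<in> insert 0 (ji_labels s)"
      show ?thesis
        unfolding y_low(2)[OF kl(1) *(1)] y_low(2)[OF kl(2) *(2)]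
        by (cases k l rule: linorder_le_cases) auto
    next
      assume *: "k \<notin> insert 0 (ji_labels s)" "l \<notin> insert 0 (ji_labels s)"
      show ?thesis
        unfolding y_high(2)[OF kl(1) *(1)] y_high(2)[OF kl(2) *(2)]
        by (cases k l rule: linorder_le_cases) auto
    qed (use y_low(2) y_high(2) kl in \<open>auto\<close>)
    then show ?thesis
      using ji_labels_subset_iff yc kl by blast
  qed
  have comp_s: "y k \<sqsubseteq> s \<or> s \<sqsubseteq> y k" if "k \<le> n" for k
    using y_low(1)[OF that] y_high(1)[OF that] by blast
  have chain: "chain_of L D"
  proof -
    have "\<forall>a\<in>y ` {0..n}. a \<sqsubseteq> s \<or> s \<sqsubseteq> a" "\<forall>a\<in>y ` {0..n}. \<forall>b\<in>y ` {0..n}. a \<sqsubseteq> b \<or> b \<sqsubseteq> a"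
      by (simp_all add: comp comp_s)
    then show ?thesis
      unfolding chain_of_iff D_def using s yc by auto
  qed
  \<comment> \<open>The two elements differ in the label \<open>k\<close> if \<open>l\<close> is a
    label of \<open>s\<close> and \<open>k\<close> is positive and not one, and in the label
    \<open>l\<close> otherwise.\<close>
  have neq: "y k \<noteq> y l" if kl: "k < l" "l \<le> n" for k l
  proof -
    have l: "l \<in> {1..n}" using kl by simp
    show ?thesis
    proof (cases "l \<in> ji_labels s")
      case True
      show ?thesis
      proof (cases "k \<in> insert 0 (ji_labels s)")
        case k: True
        have "l \<in> ji_labels (y l)" "l \<notin> ji_labels (y k)"
          using y_low(2)[of l] y_low(2)[of k] True k kl l by auto
        then show ?thesis by metis
      next
        case k: False
        have "k \<in> ji_labels (y k)" "k \<notin> ji_labels (y l)"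
          using y_low(2)[of l] y_high(2)[of k] True k kl l by auto
        then show ?thesis by metis
      qed
    next
      case False
      have "l \<in> ji_labels (y l)"
        using y_high(2)[of l] False kl l by auto
      moreover have "l \<notin> ji_labels (y k)"
        using y_high(2)[of k] y_low(2)[of k] False kl
        by (cases "k \<in> insert 0 (ji_labels s)") auto
      ultimately show ?thesis by metis
    qed
  qed
  \<comment> \<open>The \<open>y l\<close> alone already number \<open>Suc n\<close>, the largest
    size of a chain, so inserting \<open>s\<close> leaves a longest chain, now known to contain
    \<open>s\<close>.\<close>
  have "inj_on y {0..n}"
    by (rule linorder_inj_onI) (use neq in auto)
  then have "Suc n = card (y ` {0..n})"
    by (simp add: card_image)
  also have "\<dots> \<le> card D"
    unfolding D_def by (intro card_mono) auto
  finally have "card D = Suc n"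
    using card_chain_le[OF chain] by simp
  then show ?thesis
    using chain unfolding spine_set_eq D_def by blast
qed

lemma spine_set_eq_split: "s \<in> spine_set L \<longleftrightarrow> split_elem s"
  using split_elem_spine spine_set_split_elem by blast

section \<open>Lower covers in the spine\<close>

text \<open>If \<open>i\<close> is the least label of \<open>s\<close> missing in \<open>t\<close>,
  the join of \<open>t\<close> with the meet of \<open>s\<close> and \<open>x i\<close> adds the
  label \<open>i\<close> alone. It lies in the spine, strictly above \<open>t\<close> and below
  \<open>s\<close>, hence equals \<open>s\<close>.\<close>

lemma ji_labels_lower_cover_spine:
  assumes s: "s \<in> spine_set L" and t: "t \<in> lower_covers (spine L) s"
  obtains i where "i \<in> ji_labels s" "ji_labels t = ji_labels s - {i}"
proof -
  have t': "t \<in> spine_set L" "t \<sqsubseteq> s" "t \<noteq> s"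
    and cov: "\<And>z. z \<in> spine_set L \<Longrightarrow> t \<sqsubset> z \<Longrightarrow> z \<sqsubset> s \<Longrightarrow> False"
    using t by (auto simp: lower_covers_def spine_def lless_def eq_is_equal)
  have c: "s \<in> carrier L" "t \<in> carrier L"
    using s t' spine_set_subset by auto
  have "ji_labels t \<subset> ji_labels s"
    using ji_labels_subset_iff[of t s] ji_labels_inj[of t s] c t' by blast
  then have ne: "ji_labels s - ji_labels t \<noteq> {}"
    by blast
  define i where "i = Min (ji_labels s - ji_labels t)"
  have i: "i \<in> ji_labels s" "i \<notin> ji_labels t"
    using Min_in[OF _ ne] finite_ji_labels by (auto simp: i_def)
  have i_min: "i \<le> k" if "k \<in> ji_labels s" "k \<notin> ji_labels t" for k
    using that finite_ji_labels by (auto simp: i_def)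
  have i_le: "i \<le> n"
    using i(1) ji_labels_subset[of s] by auto
  define u where "u = t \<squnion>\<^bsub>L\<^esub> (s \<sqinter>\<^bsub>L\<^esub> x i)"
  have sx: "split_elem (s \<sqinter>\<^bsub>L\<^esub> x i)"
    using split_elem_meet split_elem_x[OF i_le] s spine_set_eq_split by blast
  have u: "split_elem u" and ji_labels_u: "ji_labels u = ji_labels t \<union> (ji_labels s \<inter> {1..i})"
    using split_elem_join[OF _ sx, of t] t'(1) c ji_labels_meet[OF c(1) x_closed[OF i_le]] ji_labels_x[OF i_le]
    by (auto simp: u_def spine_set_eq_split)
  have uc: "u \<in> carrier L"
    using u by (simp add: split_elem_def)
  have "i \<in> ji_labels u"
    using i(1) ji_labels_u ji_labels_subset[of s] by auto
  then have "t \<noteq> u"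
    using i(2) by metis
  moreover have "ji_labels t \<subseteq> ji_labels u" "ji_labels u \<subseteq> ji_labels s"
    using ji_labels_u \<open>ji_labels t \<subset> ji_labels s\<close> by auto
  then have "t \<sqsubseteq> u" "u \<sqsubseteq> s"
    using ji_labels_subset_iff c uc by auto
  ultimately have "u = s"
    using cov[of u] u by (auto simp: spine_set_eq_split lless_eq)
  then have "ji_labels s = ji_labels t \<union> (ji_labels s \<inter> {1..i})"
    using ji_labels_u by simp
  moreover have "k = i" if "k \<in> ji_labels s" "k \<notin> ji_labels t" "k \<le> i" for k
    using i_min[OF that(1,2)] that(3) by simp
  ultimately have "ji_labels t = ji_labels s - {i}"
    using i by auto
  then show ?thesis
    using that i(1) by blast
qed

text \<open>The cover \<open>t\<close> lacks one label \<open>i\<close> of \<open>s\<close>. As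
  \<open>a\<close> is not below \<open>t\<close>, that label belongs to \<open>a\<close>, and
  meeting with \<open>t\<close> removes just it from \<open>a\<close>, leaving no room in between.
  The second claim recovers \<open>t\<close> from this meet, which yields injectivity.\<close>

lemma
  assumes s: "s \<in> spine_set L" and t: "t \<in> lower_covers (spine L) s"
    and a: "a \<in> carrier L" "a \<sqsubseteq> s" "\<not> a \<sqsubseteq> t"
  shows meet_lower_cover: "a \<sqinter>\<^bsub>L\<^esub> t \<in> lower_covers L a"
    and ji_labels_lower_cover: "ji_labels t = ji_labels s - (ji_labels a - ji_labels (a \<sqinter>\<^bsub>L\<^esub> t))"
proof -
  obtain i where i: "i \<in> ji_labels s" "ji_labels t = ji_labels s - {i}"
    using s t by (rule ji_labels_lower_cover_spine)
  have c: "s \<in> carrier L" "t \<in> carrier L"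
    using s t spine_set_subset by (auto simp: lower_covers_def spine_def)
  let ?b = "a \<sqinter>\<^bsub>L\<^esub> t"
  have bc: "?b \<in> carrier L"
    using a c by simp
  have "ji_labels a \<subseteq> ji_labels s" "\<not> ji_labels a \<subseteq> ji_labels t"
    using ji_labels_subset_iff a c by auto
  then have ia: "i \<in> ji_labels a" and ji_labels_b: "ji_labels ?b = ji_labels a - {i}"
    using i ji_labels_meet[OF a(1) c(2)] by auto
  then show "ji_labels t = ji_labels s - (ji_labels a - ji_labels ?b)"
    using i by auto
  have "i \<notin> ji_labels ?b"
    using ji_labels_b by simp
  then have "?b \<noteq> a"
    using ia by metis
  then have "?b \<sqsubset> a"
    using meet_left[OF a(1) c(2)] by (simp add: lless_eq)
  moreover have False if z: "z \<in> carrier L" "?b \<sqsubset> z" "z \<sqsubset> a" for z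
  proof -
    have "ji_labels ?b \<subseteq> ji_labels z" "ji_labels z \<subseteq> ji_labels a"
      using ji_labels_subset_iff z a bc by (auto simp: lless_eq)
    then have "ji_labels z = ji_labels ?b \<or> ji_labels z = ji_labels a"
      using ji_labels_b by blast
    then show False
      using ji_labels_inj z a bc by (auto simp: lless_eq)
  qed
  ultimately show "?b \<in> lower_covers L a"
    using bc by (auto simp: lower_covers_def)
qed

lemma inj_on_meet_lower_covers:
  assumes s: "s \<in> spine_set L" and a: "a \<in> carrier L" "a \<sqsubseteq> s"
  shows "inj_on (\<lambda>t. a \<sqinter>\<^bsub>L\<^esub> t) {t \<in> lower_covers (spine L) s. \<not> a \<sqsubseteq> t}"
proof (rule inj_onI)
  fix t t'
  assume t: "t \<in> {t \<in> lower_covers (spine L) s. \<not> a \<sqsubseteq> t}"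
    and t': "t' \<in> {t \<in> lower_covers (spine L) s. \<not> a \<sqsubseteq> t}"
    and eq: "a \<sqinter>\<^bsub>L\<^esub> t = a \<sqinter>\<^bsub>L\<^esub> t'"
  have "ji_labels t = ji_labels t'"
    using ji_labels_lower_cover[OF s _ a, of t] ji_labels_lower_cover[OF s _ a, of t'] t t' eq by simp
  moreover have "t \<in> carrier L" "t' \<in> carrier L"
    using t t' spine_set_subset by (auto simp: lower_covers_def spine_def)
  ultimately show "t = t'"
    using ji_labels_inj by blast
qed

end

section \<open>The coupling\<close>

context labelled_extremal_lattice
begin

section \<open>Meets, bottom and top of the spine\<close>

lemma spine_sel [simp]: "carrier (spine L) = spine_set L" "le (spine L) = le L"
  by (simp_all add: spine_def)

lemma Inf_spine:
  assumes X: "finite X" "X \<noteq> {}" "X \<subseteq> spine_set L"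
  shows "\<Sqinter>\<^bsub>L\<^esub>X \<in> spine_set L" and "\<Sqinter>\<^bsub>spine L\<^esub>X = \<Sqinter>\<^bsub>L\<^esub>X"
proof -
  have sub: "X \<subseteq> carrier L"
    using X(3) spine_set_subset by blast
  have m: "greatest L (\<Sqinter>\<^bsub>L\<^esub>X) (Lower L X)"
    using X(1) sub X(2) by (rule finite_inf_greatest)
  show spine: "\<Sqinter>\<^bsub>L\<^esub>X \<in> spine_set L"
    unfolding spine_set_eq_split
    by (rule split_elem_Inf[OF X(1,2)]) (use X(3) spine_set_eq_split in blast)
  have Lower: "Lower (spine L) X = Lower L X \<inter> spine_set L"
    using X(3) sub spine_set_subset by (auto simp: Lower_def)
  show "\<Sqinter>\<^bsub>spine L\<^esub>X = \<Sqinter>\<^bsub>L\<^esub>X"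
    \<comment> \<open>The infimum is a choice among greatest lower bounds, so both existence and
      uniqueness in the spine are shown.\<close>
    unfolding Lattice.inf_def[of "spine L"]
  proof (rule some_equality)
    show g: "greatest (spine L) (\<Sqinter>\<^bsub>L\<^esub>X) (Lower (spine L) X)"
      using m spine unfolding greatest_def Lower by auto
    fix y assume y: "greatest (spine L) y (Lower (spine L) X)"
    show "y = \<Sqinter>\<^bsub>L\<^esub>X"
    proof (rule le_antisym)
      show "y \<sqsubseteq> \<Sqinter>\<^bsub>L\<^esub>X" "\<Sqinter>\<^bsub>L\<^esub>X \<sqsubseteq> y"
        using g y unfolding greatest_def by auto
      show "y \<in> carrier L" "\<Sqinter>\<^bsub>L\<^esub>X \<in> carrier L"
        using y spine spine_set_subset unfolding greatest_def Lower by auto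
    qed
  qed
qed

lemma x_spine: "l \<le> n \<Longrightarrow> x l \<in> spine_set L"
  by (simp add: spine_set_eq_split split_elem_x)

text \<open>The fixed chain runs from the bottom to the top: \<open>x 0\<close> has no labels and
  \<open>x n\<close> has all of them. Both lie in the spine, which therefore shares these two
  elements with \<open>L\<close>.\<close>

lemma x_0_le: "a \<in> carrier L \<Longrightarrow> x 0 \<sqsubseteq> a"
  using ji_labels_subset_iff[of "x 0" a] x_closed ji_labels_x[of 0] by simp

lemma le_x_n: "a \<in> carrier L \<Longrightarrow> a \<sqsubseteq> x n"
  using ji_labels_subset_iff[of a "x n"] x_closed ji_labels_x[of n] ji_labels_subset by simp

lemma bottom_eq_x: "\<bottom>\<^bsub>L\<^esub> = x 0"
  unfolding bottom_def
  by (rule some_equality) (auto simp: least_def x_0_le x_closed intro: le_antisym)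

lemma top_eq_x: "\<top>\<^bsub>L\<^esub> = x n"
  unfolding Order.top_def
  by (rule some_equality) (auto simp: greatest_def le_x_n x_closed intro: le_antisym)

lemma bottom_spine: "\<bottom>\<^bsub>spine L\<^esub> = \<bottom>\<^bsub>L\<^esub>"
  unfolding bottom_eq_x unfolding bottom_def
  by (rule some_equality)
     (use spine_set_subset in \<open>auto simp: least_def x_0_le x_closed x_spine subset_iff intro: le_antisym\<close>)

lemma top_spine: "\<top>\<^bsub>spine L\<^esub> = \<top>\<^bsub>L\<^esub>"
  unfolding top_eq_x unfolding Order.top_def
  by (rule some_equality)
     (use spine_set_subset in \<open>auto simp: greatest_def le_x_n x_closed x_spine subset_iff intro: le_antisym\<close>)

section \<open>Coupling of the two Ungarian chains\<close>

text \<open>The invariant of the coupling: the state in \<open>L\<close> stays below the state in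
  the spine.\<close>

definition dominated :: "'a \<Rightarrow> 'a \<Rightarrow> bool" where
  "dominated a s \<longleftrightarrow> a \<in> carrier L \<and> s \<in> spine_set L \<and> a \<sqsubseteq> s"

text \<open>Each lower cover \<open>t\<close> of \<open>s\<close> in the spine that is not above
  \<open>a\<close> shares its coin with the meet of \<open>a\<close> and \<open>t\<close>, a lower
  cover of \<open>a\<close>. Whenever \<open>t\<close> is chosen, that meet is chosen too, so the
  new state in \<open>L\<close> is below \<open>t\<close>.\<close>

lemma rel_pmf_ungar_step:
  assumes "dominated a s"
  shows "rel_pmf dominated (ungar_step p L a) (ungar_step p (spine L) s)"
proof -
  have a: "a \<in> carrier L" "a \<sqsubseteq> s" and s: "s \<in> spine_set L"
    using assms by (auto simp: dominated_def)
  define A where "A = lower_covers L a"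
  define B where "B = lower_covers (spine L) s"
  define B' where "B' = {t \<in> B. \<not> a \<sqsubseteq> t}"
  have A: "A \<subseteq> carrier L" and B: "B \<subseteq> spine_set L"
    by (auto simp: A_def B_def lower_covers_def)
  have fin: "finite A" "finite B"
    using A B spine_set_subset finite_carrier by (auto intro: finite_subset)
  have h: "(\<lambda>t. a \<sqinter>\<^bsub>L\<^esub> t) ` B' \<subseteq> A"
    using meet_lower_cover[OF s _ a] by (auto simp: A_def B_def B'_def)
  have inj: "inj_on (\<lambda>t. a \<sqinter>\<^bsub>L\<^esub> t) B'"
    using inj_on_meet_lower_covers[OF s a] by (simp add: B'_def B_def)
  \<comment> \<open>The element \<open>a\<close> serves as the point outside \<open>A\<close> that
    the sharing of coins asks for.\<close>
  have notin: "a \<notin> A"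
    by (auto simp: A_def lower_covers_def lless_eq)
  have step: "dominated (\<Sqinter>\<^bsub>L\<^esub>({a} \<union> {y \<in> A. f y})) (\<Sqinter>\<^bsub>spine L\<^esub>({s} \<union> {t \<in> B. g t}))"
    if fg: "\<forall>t\<in>B'. f (a \<sqinter>\<^bsub>L\<^esub> t) = g t" for f g
  proof -
    let ?X = "{a} \<union> {y \<in> A. f y}" and ?Y = "{s} \<union> {t \<in> B. g t}"
    have X: "finite ?X" "?X \<noteq> {}" "?X \<subseteq> carrier L"
      using fin A a by auto
    have Y: "finite ?Y" "?Y \<noteq> {}" "?Y \<subseteq> spine_set L"
      using fin B s by auto
    have Yc: "?Y \<subseteq> carrier L"
      using Y(3) spine_set_subset by blast
    have gX: "greatest L (\<Sqinter>\<^bsub>L\<^esub>?X) (Lower L ?X)"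
      using X(1,3,2) by (rule finite_inf_greatest)
    have gY: "greatest L (\<Sqinter>\<^bsub>L\<^esub>?Y) (Lower L ?Y)"
      using Y(1) Yc Y(2) by (rule finite_inf_greatest)
    have mX: "\<Sqinter>\<^bsub>L\<^esub>?X \<in> carrier L"
      using gX by (rule greatest_closed)
    have le_X: "\<Sqinter>\<^bsub>L\<^esub>?X \<sqsubseteq> y" if "y \<in> ?X" for y
      using gX that X(3) by (rule greatest_Lower_below)
    have "\<Sqinter>\<^bsub>L\<^esub>?X \<sqsubseteq> t" if "t \<in> ?Y" for t
    proof -
      have tc: "t \<in> carrier L"
        using that Yc by blast
      show ?thesis
      proof (cases "a \<sqsubseteq> t")
        \<comment> \<open>Members of \<open>?Y\<close> above \<open>a\<close>, among them
          \<open>s\<close>, are above the new state because it lies below \<open>a\<close>.\<close>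
        case True
        then show ?thesis
          using le_trans[OF le_X True] mX a(1) tc by simp
      next
        case False
        then have "t \<in> B'" "g t"
          using that a by (auto simp: B'_def)
        then have "a \<sqinter>\<^bsub>L\<^esub> t \<in> ?X"
          using fg h by auto
        then show ?thesis
          using le_trans[OF le_X meet_right[OF a(1) tc]] mX a(1) tc by simp
      qed
    qed
    then have "\<Sqinter>\<^bsub>L\<^esub>?X \<in> Lower L ?Y"
      using mX by (auto simp: Lower_def)
    then have "\<Sqinter>\<^bsub>L\<^esub>?X \<sqsubseteq> \<Sqinter>\<^bsub>L\<^esub>?Y"
      by (rule greatest_le[OF gY])
    then show ?thesis
      using mX Inf_spine[OF Y] by (simp add: dominated_def)
  qed
  show ?thesis
    unfolding ungar_step_def pmf.rel_map A_def[symmetric] B_def[symmetric]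
    by (rule pmf.rel_mono_strong[OF rel_pmf_Pi_pmf_inj_on[OF fin _ h inj notin]])
       (auto simp: B'_def intro!: step[unfolded B'_def, simplified])
qed

text \<open>Both chains start at the common top, and only the bottom lies below the bottom, so the
  comparison of hitting times applies to \<open>dominated\<close>.\<close>

lemma expected_ungar_time_le_spine: "expected_ungar_time p L \<le> expected_ungar_time p (spine L)"
  unfolding expected_ungar_time_def bottom_spine top_spine
proof (rule nn_integral_hitting_time_mono[where R = dominated])
  show "dominated \<top>\<^bsub>L\<^esub> \<top>\<^bsub>L\<^esub>"
    unfolding top_eq_x dominated_def using x_closed[of n] x_spine[of n] by simp
  show "a = \<bottom>\<^bsub>L\<^esub>" if "dominated a \<bottom>\<^bsub>L\<^esub>" for a
    using that x_0_le[of a] x_closed[of 0] unfolding bottom_eq_x dominated_def by (auto intro: le_antisym)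
qed (rule rel_pmf_ungar_step)

end

theorem theorem1p12:
  fixes L :: "('a, 'b) gorder_scheme" and p :: real
  assumes "lattice L" and "finite (carrier L)" and "carrier L \<noteq> {}"
    and "trim L"
    and "0 < p" and "p \<le> 1"
  shows "expected_ungar_time p L \<le> expected_ungar_time p (spine L)"
proof -
  interpret extremal_lattice L
    using assms by (intro extremal_lattice.intro extremal_lattice_axioms.intro) (auto simp: trim_def)
  \<comment> \<open>Any labelling will do, since the claim does not mention it.\<close>
  obtain x ji mi :: "nat \<Rightarrow> 'a" where labels:
    "\<And>l. l \<le> n \<Longrightarrow> x l \<in> carrier L"
    "bij_betw ji {1..n} (join_irreducibles L)"
    "bij_betw mi {1..n} (meet_irreducibles L)"
    "\<And>k l. k \<in> {1..n} \<Longrightarrow> l \<le> n \<Longrightarrow> ji k \<sqsubseteq>\<^bsub>L\<^esub> x l \<longleftrightarrow> k \<le> l"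
    "\<And>k l. k \<in> {1..n} \<Longrightarrow> l \<le> n \<Longrightarrow> x l \<sqsubseteq>\<^bsub>L\<^esub> mi k \<longleftrightarrow> l < k"
    "\<And>k. k \<in> {1..n} \<Longrightarrow> \<not> ji k \<sqsubseteq>\<^bsub>L\<^esub> mi k"
    by (rule ex_labelling) (rule that; assumption)
  interpret labelled_extremal_lattice L x ji mi
    by unfold_locales (fact labels)+
  show ?thesis
    by (rule expected_ungar_time_le_spine)
qed

end
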